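(* Let $R$ be a ring, $M$ a left $R$-module, $k \ge 1$, and let $M_1, M_2, \dots, M_k$ be submodules of $M$ with $M = M_1 + M_2 + \dots + M_k$. If $M_i$ is g-radical supplemented for every $i = 1, 2, \dots, k$, then $M$ is also g-radical supplemented.
   Context: All rings are associative with identity and all modules are unital left modules. $N \le M$ means $N$ is a submodule of $M$. A submodule $N \le M$ is essential if $K \cap N \ne 0$ for every nonzero submodule $K$ of $M$. The generalized radical $Rad_g M$ of a module $M$ is the intersection of all maximal submodules of $M$ that are essential in $M$; if $M$ has no such submodule, $Rad_g M = M$. For $U, V \le M$, $V$ is a g-radical supplement of $U$ in $M$ if $M = U + V$ and $U \cap V \le Rad_g V$. The module $M$ is g-radical supplemented if every submodule of $M$ has a g-radical supplement in $M$. *)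

theory Defs
  imports "HOL-Algebra.Algebra"
begin

text \<open>The library locale \<^locale>\<open>module\<close> assumes a commutative ring of scalars. The axioms below are
  the same over an arbitrary ring. The library predicate \<^const>\<open>submodule\<close> does not assume
  commutativity and is used as it is. A submodule \<open>N\<close> of \<open>M\<close>, regarded as a module in its own right,
  is \<open>M\<lparr>carrier := N\<rparr>\<close>.\<close>

locale left_module = R?: ring R + M?: abelian_group M
  for R :: "('a, 'r) ring_scheme" (structure) and M :: "('a, 'b, 'm) module_scheme" (structure) +
  assumes smult_closed [simp, intro]:
      "\<lbrakk>a \<in> carrier R; x \<in> carrier M\<rbrakk> \<Longrightarrow> a \<odot>\<^bsub>M\<^esub> x \<in> carrier M"
    and smult_l_distr:
      "\<lbrakk>a \<in> carrier R; b \<in> carrier R; x \<in> carrier M\<rbrakk> \<Longrightarrow>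
      (a \<oplus> b) \<odot>\<^bsub>M\<^esub> x = a \<odot>\<^bsub>M\<^esub> x \<oplus>\<^bsub>M\<^esub> b \<odot>\<^bsub>M\<^esub> x"
    and smult_r_distr:
      "\<lbrakk>a \<in> carrier R; x \<in> carrier M; y \<in> carrier M\<rbrakk> \<Longrightarrow>
      a \<odot>\<^bsub>M\<^esub> (x \<oplus>\<^bsub>M\<^esub> y) = a \<odot>\<^bsub>M\<^esub> x \<oplus>\<^bsub>M\<^esub> a \<odot>\<^bsub>M\<^esub> y"
    and smult_assoc1:
      "\<lbrakk>a \<in> carrier R; b \<in> carrier R; x \<in> carrier M\<rbrakk> \<Longrightarrow>
      (a \<otimes> b) \<odot>\<^bsub>M\<^esub> x = a \<odot>\<^bsub>M\<^esub> (b \<odot>\<^bsub>M\<^esub> x)"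
    and smult_one [simp]:
      "x \<in> carrier M \<Longrightarrow> \<one> \<odot>\<^bsub>M\<^esub> x = x"

lemma module_iff_left_module: "module R M \<longleftrightarrow> cring R \<and> left_module R M"
  by (auto simp: module_def module_axioms_def left_module_def left_module_axioms_def cring_def)

lemma (in left_module) submodule_is_left_module:
  assumes "submodule N R M"
  shows "left_module R (M\<lparr>carrier := N\<rparr>)"
proof -
  interpret N: submodule N R M by fact
  have NM: "x \<in> carrier M" if "x \<in> N" for x
    using N.subset that by auto
  have "abelian_monoid (M\<lparr>carrier := N\<rparr>)"
    using comm_monoid.submonoid_is_comm_monoid[OF M.a_comm_monoid
        N.subgroup_is_submonoid]
    unfolding abelian_monoid_def by simp
  moreover have "comm_group (add_monoid (M\<lparr>carrier := N\<rparr>))"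
    using N.subgroup_is_group[OF M.a_group] calculation
    by (simp add: comm_group_def abelian_monoid_def)
  ultimately have "abelian_group (M\<lparr>carrier := N\<rparr>)"
    by (intro abelian_group.intro abelian_group_axioms.intro)
  then show ?thesis
    by (auto intro!: left_module.intro left_module_axioms.intro R.ring_axioms
        simp: NM smult_l_distr smult_r_distr smult_assoc1)
qed

definition essential_submodule ::
    "('a, 'r) ring_scheme \<Rightarrow> ('a, 'b, 'm) module_scheme \<Rightarrow> 'b set \<Rightarrow> bool" where
  "essential_submodule R M N \<longleftrightarrow>
    submodule N R M \<and>
    (\<forall>K. submodule K R M \<and> K \<noteq> {\<zero>\<^bsub>M\<^esub>} \<longrightarrow> K \<inter> N \<noteq> {\<zero>\<^bsub>M\<^esub>})"

definition maximal_submodule ::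
    "('a, 'r) ring_scheme \<Rightarrow> ('a, 'b, 'm) module_scheme \<Rightarrow> 'b set \<Rightarrow> bool" where
  "maximal_submodule R M N \<longleftrightarrow>
    submodule N R M \<and> N \<noteq> carrier M \<and>
    (\<forall>K. submodule K R M \<and> N \<subseteq> K \<longrightarrow> K = N \<or> K = carrier M)"

definition g_radical ::
    "('a, 'r) ring_scheme \<Rightarrow> ('a, 'b, 'm) module_scheme \<Rightarrow> 'b set" where
  "g_radical R M =
    (if \<exists>N. maximal_submodule R M N \<and> essential_submodule R M N
     then \<Inter>{N. maximal_submodule R M N \<and> essential_submodule R M N}
     else carrier M)"

text \<open>\<open>g_radical_supplement R M U V\<close>: \<open>V\<close> is a g-radical supplement of \<open>U\<close> in \<open>M\<close>.\<close>

definition g_radical_supplement ::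
    "('a, 'r) ring_scheme \<Rightarrow> ('a, 'b, 'm) module_scheme \<Rightarrow> 'b set \<Rightarrow> 'b set \<Rightarrow> bool" where
  "g_radical_supplement R M U V \<longleftrightarrow>
    submodule U R M \<and> submodule V R M \<and>
    carrier M = U <+>\<^bsub>M\<^esub> V \<and> U \<inter> V \<subseteq> g_radical R (M\<lparr>carrier := V\<rparr>)"

definition g_radical_supplemented ::
    "('a, 'r) ring_scheme \<Rightarrow> ('a, 'b, 'm) module_scheme \<Rightarrow> bool" where
  "g_radical_supplemented R M \<longleftrightarrow>
    (\<forall>U. submodule U R M \<longrightarrow> (\<exists>V. g_radical_supplement R M U V))"

text \<open>Intended for finite index sets only: \<^const>\<open>finsum\<close> has no meaningful value when infinitely many
  summands are nonzero.\<close>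

definition submodule_sum ::
    "('a, 'b, 'm) module_scheme \<Rightarrow> ('i \<Rightarrow> 'b set) \<Rightarrow> 'i set \<Rightarrow> 'b set" where
  "submodule_sum M N I = {finsum M x I | x. \<forall>i\<in>I. x i \<in> N i}"

end

theory Submission
  imports Defs
begin

text \<open>The generalized radical is monotone in the module: a maximal essential submodule \<open>K\<close> of \<open>M\<close>
  either contains a given submodule \<open>A\<close> or meets it in a maximal essential submodule of \<open>A\<close>.
  Suppose that \<open>L\<close> is g-radical supplemented and \<open>U + L\<close> has a g-radical supplement \<open>V\<close>. If \<open>Y\<close> is a
  g-radical supplement of \<open>(U + V) \<inter> L\<close> in \<open>L\<close>, then \<open>V + Y\<close> is one of \<open>U\<close> in \<open>M\<close>, because
  \<open>U \<inter> (V + Y) \<le> (U + L) \<inter> V + (U + V) \<inter> Y\<close>. Starting from the supplement \<open>0\<close> of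
  \<open>U + M\<^sub>1 + \<dots> + M\<^sub>k = M\<close>, the summands \<open>M\<^sub>i\<close> can thus be removed one at a time.\<close>

context left_module
begin

section \<open>Submodules: a closure criterion, passage to a submodule, intersections and
  sums\<close>

lemma smult_minus_one:
  assumes x: "x \<in> carrier M"
  shows "(\<ominus> \<one>) \<odot>\<^bsub>M\<^esub> x = \<ominus>\<^bsub>M\<^esub> x"
proof -
  have "\<zero> \<odot>\<^bsub>M\<^esub> x \<oplus>\<^bsub>M\<^esub> \<zero> \<odot>\<^bsub>M\<^esub> x = \<zero> \<odot>\<^bsub>M\<^esub> x"
    using smult_l_distr[OF R.zero_closed R.zero_closed x] by simp
  then have "\<zero> \<odot>\<^bsub>M\<^esub> x = \<zero>\<^bsub>M\<^esub>"
    using x by (simp add: M.add.l_cancel_one)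
  then have "(\<ominus> \<one>) \<odot>\<^bsub>M\<^esub> x \<oplus>\<^bsub>M\<^esub> x = \<zero>\<^bsub>M\<^esub>"
    using smult_l_distr[of "\<ominus> \<one>" "\<one>" x] x by (simp add: R.l_neg)
  then show ?thesis
    using x by (intro M.minus_equality[symmetric]) auto
qed

text \<open>Negation is multiplication by \<open>\<ominus> \<one>\<close>, so closure under inverses
  follows from closure under scalars.\<close>

lemma submodule_iff:
  "submodule L R M \<longleftrightarrow>
    L \<subseteq> carrier M \<and> \<zero>\<^bsub>M\<^esub> \<in> L \<and> (\<forall>x\<in>L. \<forall>y\<in>L. x \<oplus>\<^bsub>M\<^esub> y \<in> L) \<and>
    (\<forall>a\<in>carrier R. \<forall>x\<in>L. a \<odot>\<^bsub>M\<^esub> x \<in> L)"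
  (is "_ \<longleftrightarrow> ?rhs")
proof
  assume "submodule L R M"
  then interpret L: submodule L R M .
  show ?rhs
    using L.subset L.one_closed L.m_closed L.smult_closed by auto
next
  assume L: ?rhs
  then have "\<ominus>\<^bsub>M\<^esub> x \<in> L" if "x \<in> L" for x
    using that smult_minus_one[of x] R.add.inv_closed[OF R.one_closed] by (metis subsetD)
  then have "subgroup L (add_monoid M)"
    using L by (intro subgroup.intro) (auto simp: a_inv_def)
  then show "submodule L R M"
    using L by (auto simp: submodule_def submodule_axioms_def)
qed

lemma submodule_minus_closed:
  assumes "submodule L R M" "x \<in> L"
  shows "\<ominus>\<^bsub>M\<^esub> x \<in> L"
proof -
  interpret L: submodule L R M by fact
  show ?thesis
    using L.m_inv_closed[OF assms(2)] by (simp add: a_inv_def)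
qed

text \<open>Restriction to \<open>A\<close> changes only the carrier, so the criterion
  \<open>submodule_iff\<close> uses the same operations on both sides. Arguments about
  \<open>A\<close> as a module can then be carried out inside \<open>M\<close>.\<close>

lemma submodule_restrict_iff:
  assumes "submodule A R M"
  shows "submodule L R (M\<lparr>carrier := A\<rparr>) \<longleftrightarrow> submodule L R M \<and> L \<subseteq> A"
  using assms
  by (auto simp: left_module.submodule_iff[OF submodule_is_left_module[OF assms]] submodule_iff)

lemma submodule_inter:
  "submodule A R M \<Longrightarrow> submodule B R M \<Longrightarrow> submodule (A \<inter> B) R M"
  by (auto simp: submodule_iff)

lemma submodule_zero: "submodule {\<zero>\<^bsub>M\<^esub>} R M"
proof -
  have "a \<odot>\<^bsub>M\<^esub> \<zero>\<^bsub>M\<^esub> = \<zero>\<^bsub>M\<^esub>" if "a \<in> carrier R" for a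
    using smult_r_distr[OF that M.zero_closed M.zero_closed] that
    by (metis M.add.l_cancel_one M.l_zero M.zero_closed smult_closed)
  then show ?thesis
    by (auto simp: submodule_iff)
qed

lemma mem_set_add: "x \<in> A <+>\<^bsub>M\<^esub> B \<longleftrightarrow> (\<exists>a\<in>A. \<exists>b\<in>B. x = a \<oplus>\<^bsub>M\<^esub> b)"
  by (auto simp: set_add_def')

lemma set_addI: "a \<in> A \<Longrightarrow> b \<in> B \<Longrightarrow> a \<oplus>\<^bsub>M\<^esub> b \<in> A <+>\<^bsub>M\<^esub> B"
  by (auto simp: mem_set_add)

lemma submodule_add:
  assumes A: "submodule A R M" and B: "submodule B R M"
  shows "submodule (A <+>\<^bsub>M\<^esub> B) R M"
  unfolding submodule_iff
proof (intro conjI ballI)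
  have sub: "A \<subseteq> carrier M" "B \<subseteq> carrier M"
    using A B by (auto simp: submodule_iff)
  show "A <+>\<^bsub>M\<^esub> B \<subseteq> carrier M"
    using sub by (auto simp: mem_set_add subset_iff)
  show "\<zero>\<^bsub>M\<^esub> \<in> A <+>\<^bsub>M\<^esub> B"
    using A B unfolding mem_set_add submodule_iff by (metis M.l_zero M.zero_closed)
  fix x assume "x \<in> A <+>\<^bsub>M\<^esub> B"
  then obtain a b where x: "a \<in> A" "b \<in> B" "x = a \<oplus>\<^bsub>M\<^esub> b"
    by (auto simp: mem_set_add)
  {
    fix y assume "y \<in> A <+>\<^bsub>M\<^esub> B"
    then obtain a' b' where y: "a' \<in> A" "b' \<in> B" "y = a' \<oplus>\<^bsub>M\<^esub> b'"
      by (auto simp: mem_set_add)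
    have "x \<oplus>\<^bsub>M\<^esub> y = (a \<oplus>\<^bsub>M\<^esub> a') \<oplus>\<^bsub>M\<^esub> (b \<oplus>\<^bsub>M\<^esub> b')"
    proof -
      have "a \<in> carrier M" "a' \<in> carrier M" "b \<in> carrier M" "b' \<in> carrier M"
        using x(1,2) y(1,2) sub by auto
      then show ?thesis
        by (simp add: x(3) y(3) M.a_ac)
    qed
    moreover have "a \<oplus>\<^bsub>M\<^esub> a' \<in> A" "b \<oplus>\<^bsub>M\<^esub> b' \<in> B"
      using A B x(1,2) y(1,2) by (auto simp: submodule_iff)
    ultimately show "x \<oplus>\<^bsub>M\<^esub> y \<in> A <+>\<^bsub>M\<^esub> B"
      by (simp add: set_addI)
  }
  fix r assume r: "r \<in> carrier R"
  have "r \<odot>\<^bsub>M\<^esub> x = r \<odot>\<^bsub>M\<^esub> a \<oplus>\<^bsub>M\<^esub> r \<odot>\<^bsub>M\<^esub> b"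
    using x sub r by (auto intro: smult_r_distr)
  moreover have "r \<odot>\<^bsub>M\<^esub> a \<in> A" "r \<odot>\<^bsub>M\<^esub> b \<in> B"
    using A B x(1,2) r by (auto simp: submodule_iff)
  ultimately show "r \<odot>\<^bsub>M\<^esub> x \<in> A <+>\<^bsub>M\<^esub> B"
    by (simp add: set_addI)
qed

lemma subset_set_add:
  assumes "submodule A R M" "submodule B R M"
  shows "A \<subseteq> A <+>\<^bsub>M\<^esub> B" "B \<subseteq> A <+>\<^bsub>M\<^esub> B"
proof -
  have sub: "A \<subseteq> carrier M" "\<zero>\<^bsub>M\<^esub> \<in> A" "B \<subseteq> carrier M" "\<zero>\<^bsub>M\<^esub> \<in> B"
    using assms by (auto simp: submodule_iff)
  have "x \<in> A <+>\<^bsub>M\<^esub> B" if "x \<in> A" for x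
    using set_addI[OF that sub(4)] that sub(1) by (simp add: subset_iff)
  then show "A \<subseteq> A <+>\<^bsub>M\<^esub> B" ..
  have "x \<in> A <+>\<^bsub>M\<^esub> B" if "x \<in> B" for x
    using set_addI[OF sub(2) that] that sub(3) by (simp add: subset_iff)
  then show "B \<subseteq> A <+>\<^bsub>M\<^esub> B" ..
qed

section \<open>The generalized radical and its monotonicity\<close>

lemma mem_g_radical_iff:
  "x \<in> g_radical R M \<longleftrightarrow>
    x \<in> carrier M \<and> (\<forall>K. maximal_submodule R M K \<and> essential_submodule R M K \<longrightarrow> x \<in> K)"
proof (cases "\<exists>K. maximal_submodule R M K \<and> essential_submodule R M K")
  case True
  \<comment> \<open>One such \<open>K\<close> is needed to see that the intersection lies in
    \<open>carrier M\<close>.\<close>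
  then obtain K where K: "maximal_submodule R M K" "essential_submodule R M K"
    by blast
  then have "K \<subseteq> carrier M"
    by (simp add: maximal_submodule_def submodule_iff)
  then show ?thesis
    using K by (auto simp: g_radical_def)
\<comment> \<open>Without such a \<open>K\<close> the quantifier is vacuous, which matches the
  default value \<open>carrier M\<close>.\<close>
qed (auto simp: g_radical_def)

lemma submodule_g_radical: "submodule (g_radical R M) R M"
proof -
  have "\<zero>\<^bsub>M\<^esub> \<in> K" "\<And>x y. x \<in> K \<Longrightarrow> y \<in> K \<Longrightarrow> x \<oplus>\<^bsub>M\<^esub> y \<in> K"
    "\<And>a x. a \<in> carrier R \<Longrightarrow> x \<in> K \<Longrightarrow> a \<odot>\<^bsub>M\<^esub> x \<in> K"
    if "maximal_submodule R M K" for K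
    using that by (simp_all add: maximal_submodule_def submodule_iff)
  then show ?thesis
    unfolding submodule_iff by (simp add: mem_g_radical_iff subset_iff)
qed

text \<open>By maximality A + K = M, so A/(A \<inter> K) is isomorphic to the simple module M/K. The
  proof avoids quotients and argues with elements, by the modular law.\<close>

lemma maximal_submodule_inter:
  assumes A: "submodule A R M" and K: "maximal_submodule R M K" and "\<not> A \<subseteq> K"
  shows "maximal_submodule R (M\<lparr>carrier := A\<rparr>) (A \<inter> K)"
proof -
  have Ks: "submodule K R M"
    using K by (simp add: maximal_submodule_def)
  have "L = A" if L: "submodule L R M" "L \<subseteq> A" "A \<inter> K \<subseteq> L" "L \<noteq> A \<inter> K" for L
  proof
    show "A \<subseteq> L"
    proof
      fix a assume a: "a \<in> A"
      \<comment> \<open>Otherwise L \<subseteq> K, hence L = A \<inter> K, which is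
        excluded.\<close>
      have "L <+>\<^bsub>M\<^esub> K \<noteq> K"
        using L subset_set_add(1)[OF L(1) Ks] by auto
      then have "L <+>\<^bsub>M\<^esub> K = carrier M"
        using K submodule_add[OF L(1) Ks] subset_set_add(2)[OF L(1) Ks]
        unfolding maximal_submodule_def by blast
      then obtain l k where lk: "l \<in> L" "k \<in> K" "a = l \<oplus>\<^bsub>M\<^esub> k"
        using a A unfolding submodule_iff by (metis mem_set_add subsetD)
      then have c: "l \<in> carrier M" "k \<in> carrier M"
        using L Ks by (auto simp: submodule_iff)
      \<comment> \<open>Modular law: k is a difference of elements of A, so k \<in> A \<inter> K
        \<subseteq> L and a = l + k \<in> L.\<close>
      have "k = \<ominus>\<^bsub>M\<^esub> l \<oplus>\<^bsub>M\<^esub> a"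
        using lk c by (simp add: M.r_neg1)
      moreover have "\<ominus>\<^bsub>M\<^esub> l \<in> A"
        using submodule_minus_closed[OF L(1) lk(1)] L(2) by auto
      ultimately have "k \<in> A"
        using a A by (simp add: submodule_iff)
      then show "a \<in> L"
        using L lk by (auto simp: submodule_iff)
    qed
  qed (use L in auto)
  then show ?thesis
    using assms submodule_inter[OF A Ks]
    by (auto simp: maximal_submodule_def submodule_restrict_iff[OF A])
qed

text \<open>For L \<subseteq> A the set L \<inter> (A \<inter> K) is just L \<inter> K.\<close>

lemma essential_submodule_inter:
  assumes A: "submodule A R M" and K: "essential_submodule R M K"
  shows "essential_submodule R (M\<lparr>carrier := A\<rparr>) (A \<inter> K)"
proof -
  have "L \<inter> (A \<inter> K) \<noteq> {\<zero>\<^bsub>M\<^esub>}"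
    if "submodule L R M" "L \<subseteq> A" "L \<noteq> {\<zero>\<^bsub>M\<^esub>}" for L
    using K that by (metis Int_absorb2 Int_assoc essential_submodule_def)
  then show ?thesis
    using K submodule_inter[OF A]
    by (auto simp: essential_submodule_def submodule_restrict_iff[OF A])
qed

lemma g_radical_mono:
  assumes A: "submodule A R M"
  shows "g_radical R (M\<lparr>carrier := A\<rparr>) \<subseteq> g_radical R M"
proof
  fix x assume x: "x \<in> g_radical R (M\<lparr>carrier := A\<rparr>)"
  note mem = x[unfolded left_module.mem_g_radical_iff[OF submodule_is_left_module[OF A]]]
  have "x \<in> K" if "maximal_submodule R M K" "essential_submodule R M K" for K
    using mem maximal_submodule_inter[OF A that(1)] essential_submodule_inter[OF A that(2)]
    by (cases "A \<subseteq> K") auto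
  then show "x \<in> g_radical R M"
    using mem A by (auto simp: mem_g_radical_iff submodule_iff)
qed

text \<open>Monotonicity, applied with V + Y as the ambient module, puts both radicals into the
  radical of V + Y, which is closed under addition.\<close>

lemma g_radical_add_mem:
  assumes V: "submodule V R M" and Y: "submodule Y R M"
    and "a \<in> g_radical R (M\<lparr>carrier := V\<rparr>)" "b \<in> g_radical R (M\<lparr>carrier := Y\<rparr>)"
  shows "a \<oplus>\<^bsub>M\<^esub> b \<in> g_radical R (M\<lparr>carrier := V <+>\<^bsub>M\<^esub> Y\<rparr>)"
proof -
  note VY = submodule_add[OF V Y]
  interpret S: left_module R "M\<lparr>carrier := V <+>\<^bsub>M\<^esub> Y\<rparr>"
    by (rule submodule_is_left_module[OF VY])
  have "submodule V R (M\<lparr>carrier := V <+>\<^bsub>M\<^esub> Y\<rparr>)" "submodule Y R (M\<lparr>carrier := V <+>\<^bsub>M\<^esub> Y\<rparr>)"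
    using V Y subset_set_add[OF V Y] by (auto simp: submodule_restrict_iff[OF VY])
  then have "a \<in> g_radical R (M\<lparr>carrier := V <+>\<^bsub>M\<^esub> Y\<rparr>)" "b \<in> g_radical R (M\<lparr>carrier := V <+>\<^bsub>M\<^esub> Y\<rparr>)"
    using S.g_radical_mono assms(3,4) by auto
  then show ?thesis
    using S.submodule_g_radical by (auto simp: S.submodule_iff)
qed

section \<open>Removing one summand from a submodule that has a supplement\<close>

lemma g_radical_supplement_cancel:
  assumes U: "submodule U R M" and L: "submodule L R M"
    and supp: "g_radical_supplemented R (M\<lparr>carrier := L\<rparr>)"
    and V: "g_radical_supplement R M (U <+>\<^bsub>M\<^esub> L) V"
  shows "\<exists>W. g_radical_supplement R M U W"
proof -
  have Vs: "submodule V R M" and sum: "carrier M = (U <+>\<^bsub>M\<^esub> L) <+>\<^bsub>M\<^esub> V"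
    and radV: "(U <+>\<^bsub>M\<^esub> L) \<inter> V \<subseteq> g_radical R (M\<lparr>carrier := V\<rparr>)"
    using V by (auto simp: g_radical_supplement_def)
  note UV = submodule_add[OF U Vs]
  have "submodule ((U <+>\<^bsub>M\<^esub> V) \<inter> L) R (M\<lparr>carrier := L\<rparr>)"
    using submodule_inter[OF UV L] by (simp add: submodule_restrict_iff[OF L])
  then obtain Y where
    Y: "g_radical_supplement R (M\<lparr>carrier := L\<rparr>) ((U <+>\<^bsub>M\<^esub> V) \<inter> L) Y"
    using supp by (auto simp: g_radical_supplemented_def)
  \<comment> \<open>The radical of \<open>Y\<close> is the same whether \<open>Y\<close> is taken in
    \<open>L\<close> or in \<open>M\<close>: the second carrier update overwrites the first.\<close>
  have Ys: "submodule Y R M" "Y \<subseteq> L"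
    and sumL: "L = ((U <+>\<^bsub>M\<^esub> V) \<inter> L) <+>\<^bsub>M\<^esub> Y"
    and radY: "((U <+>\<^bsub>M\<^esub> V) \<inter> L) \<inter> Y \<subseteq> g_radical R (M\<lparr>carrier := Y\<rparr>)"
    using Y by (auto simp: g_radical_supplement_def submodule_restrict_iff[OF L] set_add_def')
  note VY = submodule_add[OF Vs Ys(1)]
  have sub: "U \<subseteq> carrier M" "V \<subseteq> carrier M" "Y \<subseteq> carrier M" "L \<subseteq> carrier M"
    using U Vs Ys L by (auto simp: submodule_iff)
  have "m \<in> U <+>\<^bsub>M\<^esub> (V <+>\<^bsub>M\<^esub> Y)" if mM: "m \<in> carrier M" for m
  proof -
    \<comment> \<open>The component l in L is split once more, by the supplement \<open>Y\<close>,
      into a part in U + V and a part in Y. Regrouping then gives U + (V + Y).\<close>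
    obtain u l x where m: "u \<in> U" "l \<in> L" "x \<in> V" "m = (u \<oplus>\<^bsub>M\<^esub> l) \<oplus>\<^bsub>M\<^esub> x"
      using mM unfolding sum by (auto simp: mem_set_add)
    obtain u' x' y where l: "u' \<in> U" "x' \<in> V" "y \<in> Y" "l = (u' \<oplus>\<^bsub>M\<^esub> x') \<oplus>\<^bsub>M\<^esub> y"
      using subsetD[OF equalityD1[OF sumL] m(2)] by (auto simp: mem_set_add)
    have "m = (u \<oplus>\<^bsub>M\<^esub> u') \<oplus>\<^bsub>M\<^esub> ((x \<oplus>\<^bsub>M\<^esub> x') \<oplus>\<^bsub>M\<^esub> y)"
    proof -
      have "u \<in> carrier M" "x \<in> carrier M" "u' \<in> carrier M" "x' \<in> carrier M" "y \<in> carrier M"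
        using m(1,3) l(1-3) sub by auto
      then show ?thesis
        by (simp add: m(4) l(4) M.a_ac)
    qed
    moreover have "u \<oplus>\<^bsub>M\<^esub> u' \<in> U" "x \<oplus>\<^bsub>M\<^esub> x' \<in> V"
      using m l U Vs by (auto simp: submodule_iff)
    ultimately show ?thesis
      using l(3) by (simp add: set_addI)
  qed
  then have "carrier M = U <+>\<^bsub>M\<^esub> (V <+>\<^bsub>M\<^esub> Y)"
    using submodule_add[OF U VY] by (auto simp: submodule_iff)
  moreover have "U \<inter> (V <+>\<^bsub>M\<^esub> Y) \<subseteq> g_radical R (M\<lparr>carrier := V <+>\<^bsub>M\<^esub> Y\<rparr>)"
  proof
    fix u assume "u \<in> U \<inter> (V <+>\<^bsub>M\<^esub> Y)"
    then obtain x y where u: "u \<in> U" "x \<in> V" "y \<in> Y" "u = x \<oplus>\<^bsub>M\<^esub> y"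
      by (auto simp: mem_set_add)
    then have c: "x \<in> carrier M" "y \<in> carrier M"
      using sub by auto
    \<comment> \<open>As y \<in> Y \<subseteq> L, the element x = u - y lies in (U + L) \<inter> V.
      Likewise y = u - x lies in (U + V) \<inter> L \<inter> Y. These are the two intersections
      controlled by \<open>radV\<close> and \<open>radY\<close>.\<close>
    have "x = u \<oplus>\<^bsub>M\<^esub> \<ominus>\<^bsub>M\<^esub> y"
      using c by (simp add: u(4) M.a_assoc M.r_neg)
    moreover have "y = u \<oplus>\<^bsub>M\<^esub> \<ominus>\<^bsub>M\<^esub> x"
      using c by (simp add: u(4) M.a_comm[of x y] M.a_assoc M.r_neg)
    moreover have "\<ominus>\<^bsub>M\<^esub> y \<in> L" "\<ominus>\<^bsub>M\<^esub> x \<in> V"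
      using u submodule_minus_closed[OF Ys(1)] submodule_minus_closed[OF Vs] Ys(2) by auto
    ultimately have "x \<in> U <+>\<^bsub>M\<^esub> L" "y \<in> U <+>\<^bsub>M\<^esub> V"
      using u(1) by (metis set_addI)+
    then have "x \<in> g_radical R (M\<lparr>carrier := V\<rparr>)" "y \<in> g_radical R (M\<lparr>carrier := Y\<rparr>)"
      using radV radY u Ys(2) by auto
    then show "u \<in> g_radical R (M\<lparr>carrier := V <+>\<^bsub>M\<^esub> Y\<rparr>)"
      using g_radical_add_mem[OF Vs Ys(1)] u(4) by simp
  qed
  ultimately show ?thesis
    using U VY by (auto simp: g_radical_supplement_def)
qed

section \<open>Finite sums of submodules and removal of all their summands\<close>

lemma submodule_sum_empty: "submodule_sum M N {} = {\<zero>\<^bsub>M\<^esub>}"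
  by (auto simp: submodule_sum_def)

text \<open>Splitting off one summand reduces finite sums to the binary \<open><+>\<close> and so
  opens them to induction.\<close>

lemma submodule_sum_insert:
  assumes "finite I" "i \<notin> I" and N: "\<And>j. j \<in> insert i I \<Longrightarrow> N j \<subseteq> carrier M"
  shows "submodule_sum M N (insert i I) = N i <+>\<^bsub>M\<^esub> submodule_sum M N I"
proof -
  have insert: "finsum M x (insert i I) = x i \<oplus>\<^bsub>M\<^esub> finsum M x I"
    if "\<forall>j\<in>insert i I. x j \<in> N j" for x
    using that assms by (intro M.finsum_insert) auto
  show ?thesis
  proof (intro equalityI subsetI)
    fix z assume "z \<in> submodule_sum M N (insert i I)"
    then obtain x where x: "\<forall>j\<in>insert i I. x j \<in> N j" "z = finsum M x (insert i I)"
      by (auto simp: submodule_sum_def)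
    then have "z = x i \<oplus>\<^bsub>M\<^esub> finsum M x I" "finsum M x I \<in> submodule_sum M N I"
      using insert[OF x(1)] by (auto simp: submodule_sum_def)
    then show "z \<in> N i <+>\<^bsub>M\<^esub> submodule_sum M N I"
      using x(1) by (simp add: set_addI)
  next
    fix z assume "z \<in> N i <+>\<^bsub>M\<^esub> submodule_sum M N I"
    then obtain n x where nx: "n \<in> N i" "\<forall>j\<in>I. x j \<in> N j" "z = n \<oplus>\<^bsub>M\<^esub> finsum M x I"
      by (auto simp: submodule_sum_def mem_set_add)
    \<comment> \<open>The families for \<open>I\<close> and for the summand at \<open>i\<close> are
      merged by an update at \<open>i\<close>. Since i \<notin> I, the sum over \<open>I\<close>
      does not change.\<close>
    have "finsum M (x(i := n)) I = finsum M x I"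
      using nx assms by (intro M.finsum_cong') auto
    moreover have in_N: "\<forall>j\<in>insert i I. (x(i := n)) j \<in> N j"
      using nx by auto
    ultimately have "z = finsum M (x(i := n)) (insert i I)"
      by (simp only: nx(3) insert[OF in_N] fun_upd_same)
    then show "z \<in> submodule_sum M N (insert i I)"
      unfolding submodule_sum_def using in_N by blast
  qed
qed

lemma submodule_submodule_sum:
  assumes "finite I" "\<And>i. i \<in> I \<Longrightarrow> submodule (N i) R M"
  shows "submodule (submodule_sum M N I) R M"
  using assms
proof (induction I)
  case empty
  then show ?case
    by (simp add: submodule_sum_empty submodule_zero)
next
  case (insert i I)
  then have "submodule_sum M N (insert i I) = N i <+>\<^bsub>M\<^esub> submodule_sum M N I"
    by (intro submodule_sum_insert) (auto simp: submodule_iff)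
  then show ?case
    using insert by (simp add: submodule_add)
qed

text \<open>In the induction \<open>U\<close> absorbs the summand \<open>N i\<close>, so the
  induction hypothesis is used for U + N i; this is why \<open>U\<close> is generalized. Then
  \<open>g_radical_supplement_cancel\<close> removes \<open>N i\<close>.\<close>

lemma g_radical_supplement_sum_cancel:
  assumes "finite I" "submodule U R M" "\<And>i. i \<in> I \<Longrightarrow> submodule (N i) R M"
    and "\<And>i. i \<in> I \<Longrightarrow> g_radical_supplemented R (M\<lparr>carrier := N i\<rparr>)"
    and "g_radical_supplement R M (U <+>\<^bsub>M\<^esub> submodule_sum M N I) V"
  shows "\<exists>W. g_radical_supplement R M U W"
  using assms
proof (induction I arbitrary: U)
  case empty
  then have "U <+>\<^bsub>M\<^esub> {\<zero>\<^bsub>M\<^esub>} = U"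
    by (auto simp: mem_set_add submodule_iff subset_iff)
  then show ?case
    using empty.prems by (auto simp: submodule_sum_empty)
next
  case (insert i I)
  have Ni: "submodule (N i) R M" and sum: "submodule (submodule_sum M N I) R M"
    using insert by (auto intro: submodule_submodule_sum)
  have "U <+>\<^bsub>M\<^esub> submodule_sum M N (insert i I) = (U <+>\<^bsub>M\<^esub> N i) <+>\<^bsub>M\<^esub> submodule_sum M N I"
  proof -
    have "submodule_sum M N (insert i I) = N i <+>\<^bsub>M\<^esub> submodule_sum M N I"
      using insert by (intro submodule_sum_insert) (auto simp: submodule_iff)
    moreover have "U \<subseteq> carrier M" "N i \<subseteq> carrier M" "submodule_sum M N I \<subseteq> carrier M"
      using insert.prems(1) Ni sum by (auto simp: submodule_iff)
    \<comment> \<open>\<open>set_add_def\<close> turns \<open><+>\<close> into the product of sets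
      in the additive group, where associativity is available.\<close>
    ultimately show ?thesis
      by (simp add: set_add_def M.add.set_mult_assoc)
  qed
  then have "\<exists>W. g_radical_supplement R M (U <+>\<^bsub>M\<^esub> N i) W"
    using insert submodule_add[OF insert.prems(1) Ni] by auto
  then show ?case
    using insert.prems Ni g_radical_supplement_cancel by blast
qed

end

theorem corollary2p5:
  fixes R :: "('a, 'r) ring_scheme"
    and M :: "('a, 'b, 'm) module_scheme"
    and k :: nat
    and N :: "nat \<Rightarrow> 'b set"
  assumes "left_module R M"
    and "k \<ge> 1"
    and "\<And>i. i \<in> {1..k} \<Longrightarrow> submodule (N i) R M"
    and "carrier M = submodule_sum M N {1..k}"
    and "\<And>i. i \<in> {1..k} \<Longrightarrow> g_radical_supplemented R (M\<lparr>carrier := N i\<rparr>)"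
  shows "g_radical_supplemented R M"
proof -
  interpret left_module R M by fact
  show ?thesis
    unfolding g_radical_supplemented_def
  proof (intro allI impI)
    fix U assume U: "submodule U R M"
    have M: "submodule (carrier M) R M"
      by (simp add: submodule_iff)
    have "U <+>\<^bsub>M\<^esub> carrier M = carrier M"
      using subset_set_add(2)[OF U M] submodule_add[OF U M] by (auto simp: submodule_iff)
    moreover have "g_radical_supplement R M (carrier M) {\<zero>\<^bsub>M\<^esub>}"
    proof -
      \<comment> \<open>The intersection with the zero submodule is zero, so it is enough that the
        radical of the zero module contains its zero element, as any submodule does.\<close>
      interpret Z: left_module R "M\<lparr>carrier := {\<zero>\<^bsub>M\<^esub>}\<rparr>"
        by (rule submodule_is_left_module[OF submodule_zero])
      have "\<zero>\<^bsub>M\<^esub> \<in> g_radical R (M\<lparr>carrier := {\<zero>\<^bsub>M\<^esub>}\<rparr>)"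
        using Z.submodule_g_radical by (simp add: Z.submodule_iff)
      moreover have "carrier M = carrier M <+>\<^bsub>M\<^esub> {\<zero>\<^bsub>M\<^esub>}"
        by (auto simp: mem_set_add)
      ultimately show ?thesis
        using M submodule_zero by (auto simp: g_radical_supplement_def)
    qed
    ultimately have
      "g_radical_supplement R M (U <+>\<^bsub>M\<^esub> submodule_sum M N {1..k}) {\<zero>\<^bsub>M\<^esub>}"
      using assms(4) by simp
    then show "\<exists>W. g_radical_supplement R M U W"
      using g_radical_supplement_sum_cancel[where I = "{1..k}" and N = N] U assms(3,5) by blast
  qed
qed

end
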